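(* For all complex $k$ for which all terms of the series are defined (the exceptional $k$ being removable singularities of the sum), \[ \sum_{n=0}^{\infty} \frac{(\frac12+3k)_n^2\, (\frac12-k)_n^2\, (\frac12+k)_n^3}{(1)_n^2\,(1+2k)_n^2\,(1+k)_n^3}\; \frac{(\frac12)_k\, (\frac16)_k^2\, (\frac56)_k^2}{(1)_k^5} \left(\frac{1}{64}\right)^n \left(\frac{729}{1024}\right)^k (6n+6k+1)\,(28n^2+8n+1+12k^2+56nk+8k) = \frac{32}{\pi^3}. \] In particular, for $k=0$ (Gourevitch's formula), \[ \sum_{n=0}^{\infty} \frac{(\frac12)_n^7}{(1)_n^7} \left(\frac{1}{64}\right)^n (6n+1)(28n^2+8n+1) = \frac{32}{\pi^3}. \]
   Context: For complex $a$ and integer $n\ge 0$, $(a)_n$ denotes the rising factorial: $(a)_0=1$, $(a)_n=a(a+1)\cdots(a+n-1)$. For complex $k$, $(a)_k=\Gamma(a+k)/\Gamma(a)$, and $c^k=\exp(k\ln c)$ for $c>0$ with $\ln c$ real. All terms of the series are defined whenever $2k$ is not a negative integer and neither $k+\frac16$ nor $k+\frac56$ is a non-positive integer. *)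

theory Defs
  imports "HOL-Complex_Analysis.Complex_Analysis"
begin

text \<open>
  The shifted factorial with complex index, meaningful when neither \<open>a\<close> nor \<open>a + k\<close> is a
  pole of the Gamma function (at poles, \<^const>\<open>Gamma\<close> takes the conventional value 0).
\<close>

definition rising :: "complex \<Rightarrow> complex \<Rightarrow> complex" where
  "rising a k = Gamma (a + k) / Gamma a"

definition admissible :: "complex \<Rightarrow> bool" where
  "admissible k \<longleftrightarrow>
     2 * k \<notin> \<int>\<^sub>\<le>\<^sub>0 - {0} \<and> k + 1/6 \<notin> \<int>\<^sub>\<le>\<^sub>0 \<and> k + 5/6 \<notin> \<int>\<^sub>\<le>\<^sub>0"

definition series_term :: "complex \<Rightarrow> nat \<Rightarrow> complex" where
  "series_term k n =
     (pochhammer (1/2 + 3 * k) n ^ 2 * pochhammer (1/2 - k) n ^ 2 * pochhammer (1/2 + k) n ^ 3)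
       / (pochhammer 1 n ^ 2 * pochhammer (1 + 2 * k) n ^ 2 * pochhammer (1 + k) n ^ 3)
     * ((rising (1/2) k * rising (1/6) k ^ 2 * rising (5/6) k ^ 2) / rising 1 k ^ 5)
     * (1/64) ^ n
     * (complex_of_real (729/1024) powr k)
     * (6 * of_nat n + 6 * k + 1)
     * (28 * of_nat n ^ 2 + 8 * of_nat n + 1 + 12 * k ^ 2 + 56 * of_nat n * k + 8 * k)"

text \<open>
  Only values of \<open>f\<close> in a punctured neighbourhood of \<open>z\<close> matter.
\<close>

definition removable_singularity_at :: "(complex \<Rightarrow> complex) \<Rightarrow> complex \<Rightarrow> bool" where
  "removable_singularity_at f z \<longleftrightarrow> isolated_singularity_at f z \<and> (\<exists>c. f \<midarrow>z\<rightarrow> c)"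

end

theory Submission
  imports Defs "HOL-Real_Asymp.Real_Asymp"
begin

text \<open>
  Write \<open>G(n,k)\<close> for the general term of the series and \<open>S(k)\<close> for its sum. There is a
  Wilf-Zeilberger mate \<open>F(n,k)\<close>, a hypergeometric term which is a rational multiple of
  \<open>G(n,k)\<close>, with
  \<open>G(n,k+1) - G(n,k) = F(n+1,k) - F(n,k)\<close>, \<open>F(0,k) = 0\<close> and \<open>F(n,k) \<rightarrow> 0\<close> as
  \<open>n \<rightarrow> \<infinity>\<close> (\<open>wz_pair\<close>, \<open>wz_mate_tendsto_0\<close>). Telescoping shows that \<open>S(k+1) = S(k)\<close>.

  Hence \<open>S\<close>, which is holomorphic for \<open>Re k > 0\<close>, extends to an entire function of period 1.
  An entire function of period 1 which is \<open>O(exp(\<pi> \<bar>Im k\<bar>))\<close> is constant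
  (\<open>periodic_entire_constant\<close>), so it remains to bound \<open>S\<close>. For \<open>Re k > 0\<close> the
  Gamma prefactor has modulus at most 1 (\<open>norm_term_prefactor_le_1\<close>), and the remaining
  factors of the \<open>n\<close>-th term are at most a polynomial in \<open>n\<close> and \<open>\<bar>k\<bar>\<close> times
  \<open>(9/64)^n * 4 powr \<bar>k\<bar>\<close> (\<open>norm_hyper_term_le\<close>); since \<open>ln 4 < \<pi>\<close>, this growth is slow enough.

  The constant is found at \<open>k = 1/2\<close>, where the factor \<open>(1/2 - k)\<^sub>n\<close> kills every term but
  the first, which the reflection formula evaluates to \<open>32/\<pi>\<^sup>3\<close> (\<open>series_value_half\<close>).
  For an admissible \<open>k\<close> with \<open>Re k \<le> 0\<close>, telescoping carries convergence and value over
  from \<open>k + m\<close> to \<open>k\<close>. The remaining \<open>k\<close> lie in the lattice \<open>(1/6)\<int>\<close>; near each of them \<open>S\<close>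
  is constant, so its singularity is removable.
\<close>

section \<open>Splitting the general term\<close>

definition term_prefactor :: "complex \<Rightarrow> complex" where
  "term_prefactor k = (rising (1/2) k * rising (1/6) k ^ 2 * rising (5/6) k ^ 2) / rising 1 k ^ 5
     * complex_of_real (729/1024) powr k"

definition weight :: "complex \<Rightarrow> complex \<Rightarrow> complex" where
  "weight n k = (6*n + 6*k + 1) * (28*n^2 + 8*n + 1 + 12*k^2 + 56*n*k + 8*k)"

definition hyper_term :: "complex \<Rightarrow> nat \<Rightarrow> complex" where
  "hyper_term k n =
     (pochhammer (1/2 + 3*k) n ^ 2 * pochhammer (1/2 - k) n ^ 2 * pochhammer (1/2 + k) n ^ 3)
       / (pochhammer 1 n ^ 2 * pochhammer (1 + 2*k) n ^ 2 * pochhammer (1 + k) n ^ 3)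
     * (1/64) ^ n * weight (of_nat n) k"

lemma series_term_factor: "series_term k n = term_prefactor k * hyper_term k n"
  by (simp add: series_term_def term_prefactor_def hyper_term_def weight_def mult_ac)

section \<open>Admissible parameters\<close>

text \<open>
  If \<open>k\<close> is a negative integer or half of a negative odd integer, then \<open>2k\<close> is a negative
  integer; so the single condition on \<open>2k\<close> keeps all these factors of the denominators away
  from 0.
\<close>

lemma admissible_nonzero:
  assumes "admissible k"
  shows "2 * k + of_nat (Suc j) \<noteq> 0" "k + of_nat (Suc j) \<noteq> 0" "k + 1/2 + of_nat j \<noteq> 0"
proof -
  show *: "2 * k + of_nat (Suc j) \<noteq> 0" for j
  proof
    assume "2 * k + of_nat (Suc j) = 0"
    hence "2 * k = - of_nat (Suc j)" by (simp add: eq_neg_iff_add_eq_0 del: of_nat_Suc)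
    moreover have "- of_nat (Suc j) \<in> (\<int>\<^sub>\<le>\<^sub>0 - {0} :: complex set)"
      by (simp del: of_nat_Suc)
    ultimately show False using assms by (auto simp: admissible_def)
  qed
  show "k + of_nat (Suc j) \<noteq> 0"
  proof
    assume "k + of_nat (Suc j) = 0"
    hence "2 * (k + of_nat (Suc j)) = 0" by simp
    hence "2 * k + of_nat (Suc (2*j+1)) = 0" by (simp add: algebra_simps)
    with * show False by blast
  qed
  show "k + 1/2 + of_nat j \<noteq> 0"
  proof
    assume "k + 1/2 + of_nat j = 0"
    hence "2 * (k + 1/2 + of_nat j) = 0" by simp
    hence "2 * k + of_nat (Suc (2*j)) = 0" by (simp add: algebra_simps)
    with * show False by blast
  qed
qed

lemma nonpos_Ints_minus_1: "z + 1 \<in> \<int>\<^sub>\<le>\<^sub>0 \<Longrightarrow> z \<in> \<int>\<^sub>\<le>\<^sub>0" for z :: complex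
proof -
  assume "z + 1 \<in> \<int>\<^sub>\<le>\<^sub>0"
  then obtain j where "z + 1 = - of_nat j" by (rule nonpos_Ints_cases')
  hence "z = - of_nat j - 1" by (metis add_diff_cancel_right')
  hence "z = - of_nat (Suc j)" by simp
  thus ?thesis by (metis minus_of_nat_in_nonpos_Ints)
qed

lemma admissible_plus_1:
  assumes "admissible k" shows "admissible (k + 1)"
proof -
  have "2 * (k + 1) \<notin> \<int>\<^sub>\<le>\<^sub>0"
  proof
    assume "2 * (k + 1) \<in> \<int>\<^sub>\<le>\<^sub>0"
    then obtain j where "2 * (k + 1) = - of_nat j" by (rule nonpos_Ints_cases')
    hence "2 * k + of_nat (Suc (Suc j)) = 0" by (simp add: algebra_simps)
    with admissible_nonzero(1)[OF assms] show False by blast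
  qed
  moreover have "k + 1 + 1/6 \<notin> \<int>\<^sub>\<le>\<^sub>0" "k + 1 + 5/6 \<notin> \<int>\<^sub>\<le>\<^sub>0"
    using assms nonpos_Ints_minus_1[of "k + 1/6"] nonpos_Ints_minus_1[of "k + 5/6"]
    by (auto simp: admissible_def add_ac)
  ultimately show ?thesis by (auto simp: admissible_def)
qed

lemma Re_pos_notin_nonpos_Ints:
  fixes z :: complex assumes "Re z > 0" shows "z \<notin> \<int>\<^sub>\<le>\<^sub>0"
  using assms by (auto elim!: nonpos_Ints_cases')

lemma admissible_Re_pos:
  assumes "Re k > 0" shows "admissible k"
  using Re_pos_notin_nonpos_Ints[of "2*k"] Re_pos_notin_nonpos_Ints[of "k + 1/6"]
    Re_pos_notin_nonpos_Ints[of "k + 5/6"] assms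
  by (auto simp: admissible_def)

lemma rising_plus_1:
  assumes "k + a \<notin> \<int>\<^sub>\<le>\<^sub>0" shows "rising a (k + 1) = (k + a) * rising a k"
  using Gamma_plus1[OF assms] by (simp add: rising_def add_ac)

lemma term_prefactor_plus_1:
  assumes "admissible k"
  shows "term_prefactor (k + 1) =
    term_prefactor k * (729/1024) * (k + 1/2) * (k + 1/6)^2 * (k + 5/6)^2 / (k + 1)^5"
proof -
  have "k + 1/2 \<notin> \<int>\<^sub>\<le>\<^sub>0"
    using admissible_nonzero(3)[OF assms] by (metis nonpos_Ints_cases' eq_neg_iff_add_eq_0)
  moreover have "k + 1 \<notin> \<int>\<^sub>\<le>\<^sub>0"
    using admissible_nonzero(2)[OF assms]
    by (metis nonpos_Ints_cases' eq_neg_iff_add_eq_0 of_nat_Suc add.assoc add.commute)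
  ultimately have r: "rising (1/2) (k+1) = (k + 1/2) * rising (1/2) k"
     "rising 1 (k+1) = (k + 1) * rising 1 k"
     "rising (1/6) (k+1) = (k + 1/6) * rising (1/6) k"
     "rising (5/6) (k+1) = (k + 5/6) * rising (5/6) k"
    using assms by (simp_all add: rising_plus_1 admissible_def)
  have p: "complex_of_real (729/1024) powr (k+1) = complex_of_real (729/1024) powr k * (729/1024)"
    by (simp add: powr_add)
  show ?thesis
    unfolding term_prefactor_def r p by (simp add: power_mult_distrib mult_ac)
qed

lemma pochhammer_plus_1:
  fixes z :: complex assumes "z \<noteq> 0"
  shows "pochhammer (z + 1) n = pochhammer z n * (z + of_nat n) / z"
  using assms pochhammer_rec[of z n] pochhammer_Suc[of z n] by (simp add: field_simps)

section \<open>The WZ pair\<close>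

text \<open>
  The polynomial part of the mate. Once the common hypergeometric factor is divided out of the
  WZ equation, comparing degrees leaves room for a polynomial of total degree 5; its
  coefficients are the solution of the linear system given by \<open>wz_poly_identity\<close>.
\<close>

definition wz_poly :: "complex \<Rightarrow> complex \<Rightarrow> complex" where
  "wz_poly n k = 168*n^5 + (228 + 808*k)*n^4 + (-84 + 48*k + 592*k^2)*n^3
     - (186 + 1436*k + 3400*k^2 + 2544*k^3)*n^2
     - (91/2 + 764*k + 3724*k^2 + 7184*k^3 + 4856*k^4)*n
     - (15/4 + 167/2*k + 706*k^2 + 2532*k^3 + 4028*k^4 + 2360*k^5)"

lemma wz_poly_identity:
  "((n + 3*k + 1/2) * (n + 3*k + 3/2) * (n + 3*k + 5/2))^2 * (n + k + 1/2)^3 * weight n (k + 1)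
     - 64 * (n - k - 1/2)^2 * ((n + 2*k + 1) * (n + 2*k + 2))^2 * (n + k + 1)^3 * weight n k
   = (n + 3*k + 1/2)^2 * (n - k - 1/2)^2 * (n + k + 1/2)^3 * wz_poly (n + 1) k
     - 64 * n^2 * (n + 2*k + 2)^2 * (n + k + 1)^3 * wz_poly n k"
  unfolding wz_poly_def weight_def by algebra

text \<open>
  The common factor of the four terms in the WZ equation. The symbol \<open>(1/2 - k)\<^sub>n\<close> of the series
  is traded for \<open>(-1/2 - k)\<^sub>n\<close>, so that \<open>wz_base\<close> stays meaningful at \<open>k = n - 1/2\<close>, where
  the quotient \<open>(1/2 - k)\<^sub>n / (n - k - 1/2)\<close> would read 0/0.
\<close>

definition wz_base :: "complex \<Rightarrow> nat \<Rightarrow> complex" where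
  "wz_base k n = term_prefactor k *
     (pochhammer (1/2 + 3*k) n ^ 2 * pochhammer (-1/2 - k) n ^ 2 * pochhammer (1/2 + k) n ^ 3)
       / (pochhammer 1 n ^ 2 * pochhammer (1 + 2*k) n ^ 2 * pochhammer (1 + k) n ^ 3)
     * (1/64) ^ n / (k + 1/2)^2"

definition wz_mate :: "complex \<Rightarrow> nat \<Rightarrow> complex" where
  "wz_mate k n = wz_base k n * (of_nat n ^ 2 * wz_poly (of_nat n) k / (of_nat n + 2*k + 1)^2)"

lemma admissible_pochhammer_nonzero:
  assumes "admissible k"
  shows "pochhammer (1 + 2*k) n \<noteq> 0" "pochhammer (1 + k) n \<noteq> 0"
proof -
  show "pochhammer (1 + 2*k) n \<noteq> 0"
    using admissible_nonzero(1)[OF assms]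
    by (auto simp: pochhammer_eq_0_iff add_ac eq_neg_iff_add_eq_0)
  show "pochhammer (1 + k) n \<noteq> 0"
    using admissible_nonzero(2)[OF assms]
    by (auto simp: pochhammer_eq_0_iff add_ac eq_neg_iff_add_eq_0)
qed

lemma series_term_eq_wz_base:
  assumes "admissible k"
  shows "series_term k n = wz_base k n * ((of_nat n - k - 1/2)^2 * weight (of_nat n) k)"
proof -
  have nz: "k + 1/2 \<noteq> 0" using admissible_nonzero(3)[OF assms, of 0] by simp
  hence nz': "-1/2 - k \<noteq> 0" by (auto simp: algebra_simps eq_neg_iff_add_eq_0)
  have "pochhammer (1/2 - k) n = pochhammer (-1/2 - k) n * (- 1/2 - k + of_nat n) / (-1/2 - k)"
    using pochhammer_plus_1[OF nz', of n] by (simp add: algebra_simps)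
  also have "\<dots> = - (pochhammer (-1/2 - k) n * (of_nat n - k - 1/2) / (k + 1/2))"
    using nz nz' by (simp add: divide_simps) (simp add: algebra_simps)
  finally have p: "pochhammer (1/2 - k) n ^ 2 =
     pochhammer (-1/2 - k) n ^ 2 * (of_nat n - k - 1/2)^2 / (k + 1/2)^2"
    by (simp add: power_mult_distrib power_divide)
  show ?thesis
    unfolding series_term_factor hyper_term_def wz_base_def p by (simp add: mult_ac)
qed

text \<open>
  A shift of \<open>k\<close> by 1 multiplies each shifted factorial by a rational function of \<open>k\<close> and
  \<open>n\<close>. The parts depending on \<open>k\<close> alone cancel against those of the prefactor, because
  \<open>(1/2 + 3k)(3/2 + 3k)(5/2 + 3k) = 27 (k + 1/6)(k + 1/2)(k + 5/6)\<close> and \<open>27\<^sup>2 = 729\<close>.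
\<close>

lemma series_term_plus_1_eq_wz_base:
  assumes adm: "admissible k"
  shows "series_term (k + 1) n = wz_base k n *
    (((of_nat n + 3*k + 1/2) * (of_nat n + 3*k + 3/2) * (of_nat n + 3*k + 5/2))^2
       * (of_nat n + k + 1/2)^3 * weight (of_nat n) (k + 1)
     / (64 * ((of_nat n + 2*k + 1) * (of_nat n + 2*k + 2))^2 * (of_nat n + k + 1)^3))"
proof -
  define N :: complex where "N = of_nat n"
  have nz: "k + 1/2 \<noteq> 0" "k + 1/6 \<noteq> 0" "k + 5/6 \<noteq> 0" "k + 1 \<noteq> 0"
    using admissible_nonzero(3)[OF adm, of 0] admissible_nonzero(2)[OF adm, of 0] adm
    by (auto simp: admissible_def)
  have nz2: "N + 2*k + 1 \<noteq> 0" "N + 2*k + 2 \<noteq> 0" "N + k + 1 \<noteq> 0"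
    using admissible_nonzero(1)[OF adm, of n] admissible_nonzero(1)[OF adm, of "Suc n"]
          admissible_nonzero(2)[OF adm, of n]
    by (simp_all add: N_def add_ac)
  have nz3: "1/2 + 3*k \<noteq> 0" "3/2 + 3*k \<noteq> 0" "5/2 + 3*k \<noteq> 0" "1 + 2*k \<noteq> 0" "2 + 2*k \<noteq> 0"
    using nz by (auto simp: field_simps add_eq_0_iff)
  have p1: "pochhammer (1/2 + 3*(k+1)) n = pochhammer (1/2 + 3*k) n
      * ((N + 3*k + 1/2) * (N + 3*k + 3/2) * (N + 3*k + 5/2))
      / (27 * (k + 1/6) * (k + 1/2) * (k + 5/6))"
  proof -
    have "pochhammer (1/2 + 3*(k+1)) n = pochhammer (5/2 + 3*k + 1) n"
      by (simp add: algebra_simps)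
    also have "\<dots> = pochhammer (3/2 + 3*k + 1) n * (5/2 + 3*k + N) / (5/2 + 3*k)"
      using pochhammer_plus_1[OF nz3(3), of n] by (simp add: N_def algebra_simps)
    also have "pochhammer (3/2 + 3*k + 1) n
        = pochhammer (1/2 + 3*k + 1) n * (3/2 + 3*k + N) / (3/2 + 3*k)"
      using pochhammer_plus_1[OF nz3(2), of n] by (simp add: N_def algebra_simps)
    also have "pochhammer (1/2 + 3*k + 1) n
        = pochhammer (1/2 + 3*k) n * (1/2 + 3*k + N) / (1/2 + 3*k)"
      using pochhammer_plus_1[OF nz3(1), of n] by (simp add: N_def algebra_simps)
    finally have "pochhammer (1/2 + 3*(k+1)) n = pochhammer (1/2 + 3*k) n
      * ((N + 3*k + 1/2) * (N + 3*k + 3/2) * (N + 3*k + 5/2))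
      / ((1/2 + 3*k) * (3/2 + 3*k) * (5/2 + 3*k))"
      by (simp add: add_ac mult_ac)
    also have "(1/2 + 3*k) * (3/2 + 3*k) * (5/2 + 3*k) = 27 * (k + 1/6) * (k + 1/2) * (k + 5/6)"
      by algebra
    finally show ?thesis .
  qed
  have p2: "pochhammer (1/2 - (k+1)) n = pochhammer (-1/2 - k) n"
    by (rule arg_cong[of _ _ "\<lambda>z. pochhammer z n"]) simp
  have p3: "pochhammer (1/2 + (k+1)) n = pochhammer (1/2 + k) n * (N + k + 1/2) / (k + 1/2)"
    using pochhammer_plus_1[of "1/2 + k" n] nz(1) by (simp add: N_def add_ac)
  have p4: "pochhammer (1 + 2*(k+1)) n = pochhammer (1 + 2*k) n * ((N + 2*k + 1) * (N + 2*k + 2))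
      / (4 * (k + 1/2) * (k + 1))"
  proof -
    have "pochhammer (1 + 2*(k+1)) n = pochhammer (2 + 2*k + 1) n"
      by (simp add: algebra_simps)
    also have "\<dots> = pochhammer (1 + 2*k + 1) n * (2 + 2*k + N) / (2 + 2*k)"
      using pochhammer_plus_1[OF nz3(5), of n] by (simp add: N_def algebra_simps)
    also have "pochhammer (1 + 2*k + 1) n = pochhammer (1 + 2*k) n * (1 + 2*k + N) / (1 + 2*k)"
      using pochhammer_plus_1[OF nz3(4), of n] by (simp add: N_def algebra_simps)
    finally have "pochhammer (1 + 2*(k+1)) n =
        pochhammer (1 + 2*k) n * ((N + 2*k + 1) * (N + 2*k + 2)) / ((1 + 2*k) * (2 + 2*k))"
      by (simp add: add_ac mult_ac)
    also have "(1 + 2*k) * (2 + 2*k) = 4 * (k + 1/2) * (k + 1)"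
      by (simp add: algebra_simps)
    finally show ?thesis .
  qed
  have p5: "pochhammer (1 + (k+1)) n = pochhammer (1 + k) n * (N + k + 1) / (k + 1)"
    using pochhammer_plus_1[of "1 + k" n] nz(4) by (simp add: N_def add_ac)
  \<comment> \<open>The shift with every shifted factorial replaced by a variable; what remains is a rational identity.\<close>
  have gen: "(P * (729/1024) * h * p^2 * q^2 / m^5) *
       ((a * u / (27 * p * h * q))^2 * b^2 * (c * x / h)^3
         / (d^2 * (e * D / (4 * h * m))^2 * (f * y / m)^3) * z * w)
      = P * (a^2 * b^2 * c^3) / (d^2 * e^2 * f^3) * z / h^2 * (u^2 * x^3 * w / (64 * D^2 * y^3))"
    if "p \<noteq> 0" "h \<noteq> 0" "q \<noteq> 0" "m \<noteq> 0" "d \<noteq> 0" "e \<noteq> 0" "f \<noteq> 0" "D \<noteq> 0" "y \<noteq> 0"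
    for P h p q m a b c d e f u x D y z w :: complex
    using that by (simp add: field_simps power_mult_distrib power_divide eval_nat_numeral)
  show ?thesis
    unfolding series_term_factor hyper_term_def wz_base_def term_prefactor_plus_1[OF adm] p1 p2 p3 p4 p5
      N_def[symmetric]
    by (rule gen) (use nz nz2 admissible_pochhammer_nonzero[OF adm] in
        \<open>simp_all add: pochhammer_fact[symmetric]\<close>)
qed

lemma wz_base_Suc:
  "wz_base k (Suc n) = wz_base k n *
     ((of_nat n + 3*k + 1/2)^2 * (of_nat n - k - 1/2)^2 * (of_nat n + k + 1/2)^3
      / (64 * (of_nat n + 1)^2 * (of_nat n + 2*k + 1)^2 * (of_nat n + k + 1)^3))"
proof -
  have e: "1/2 + 3*k + of_nat n = of_nat n + 3*k + 1/2" "-1/2 - k + of_nat n = of_nat n - k - 1/2"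
    "1/2 + k + of_nat n = of_nat n + k + 1/2" "1 + of_nat n = of_nat n + (1 :: complex)"
    "1 + 2*k + of_nat n = of_nat n + 2*k + 1" "1 + k + of_nat n = of_nat n + k + 1"
    by (simp_all add: add_ac)
  have gen: "P * ((a*u)^2 * (b * v)^2 * (c*w)^3) / ((d*x)^2 * (e*y)^2 * (f*z)^3) * (1/64 * t) / h
      = P * (a^2 * b^2 * c^3) / (d^2 * e^2 * f^3) * t / h
          * (u^2 * v^2 * w^3 / (64 * x^2 * y^2 * z^3))"
    for P a b c d e f h t u v w x y z :: complex
    by (simp add: power_mult_distrib mult_ac)
  show ?thesis
    unfolding wz_base_def pochhammer_Suc power_Suc e by (rule gen)
qed

lemma wz_pair:
  assumes adm: "admissible k"
  shows "series_term (k + 1) n - series_term k n = wz_mate k (Suc n) - wz_mate k n"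
proof -
  define N :: complex where "N = of_nat n"
  have nz2: "N + 2*k + 1 \<noteq> 0" "N + 2*k + 2 \<noteq> 0" "N + k + 1 \<noteq> 0"
    using admissible_nonzero(1)[OF adm, of n] admissible_nonzero(1)[OF adm, of "Suc n"]
          admissible_nonzero(2)[OF adm, of n]
    by (simp_all add: N_def add_ac)
  have nz3: "N + 1 \<noteq> 0" by (simp add: N_def of_nat_Suc[symmetric] add_ac del: of_nat_Suc)
  have gen: "B * (U * w' / (64 * (D1 * D2)^2 * D3^3)) - B * (V * w)
     = B * (u / (64 * M^2 * D1^2 * D3^3)) * (M^2 * Q' / D2^2) - B * (L * Q / D1^2)"
    if "U * w' - 64 * V * (D1 * D2)^2 * D3^3 * w = u * Q' - 64 * L * D2^2 * D3^3 * Q"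
       "D1 \<noteq> 0" "D2 \<noteq> 0" "D3 \<noteq> 0" "M \<noteq> 0"
    for B U w w' D1 D2 D3 V u M Q Q' L :: complex
  proof -
    have "B * (U * w' / (64 * (D1 * D2)^2 * D3^3)) - B * (V * w)
        = B * (U * w' - 64 * V * (D1 * D2)^2 * D3^3 * w) / (64 * (D1 * D2)^2 * D3^3)"
      using that(2-) by (simp add: field_simps)
    also have "\<dots> = B * (u * Q' - 64 * L * D2^2 * D3^3 * Q) / (64 * (D1 * D2)^2 * D3^3)"
      unfolding that(1) ..
    also have "\<dots> = B * (u / (64 * M^2 * D1^2 * D3^3)) * (M^2 * Q' / D2^2) - B * (L * Q / D1^2)"
      using that(2-) by (simp add: field_simps power_mult_distrib)
    finally show ?thesis .
  qed
  have S: "of_nat (Suc n) = N + 1" "N + 1 + 2*k + 1 = N + 2*k + 2" by (simp_all add: N_def)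
  show ?thesis
    unfolding series_term_eq_wz_base[OF adm] series_term_plus_1_eq_wz_base[OF adm] wz_mate_def
      wz_base_Suc N_def[symmetric] S
    by (rule gen[OF wz_poly_identity nz2]) (use nz2 nz3 in auto)
qed

section \<open>Telescoping in \<open>n\<close>\<close>

lemma quotient_of_nat_tendsto_1:
  fixes a b :: complex
  shows "(\<lambda>n. (a + of_nat n) / (b + of_nat n)) \<longlonglongrightarrow> 1"
proof -
  have inf: "filterlim (\<lambda>n. b + of_nat n) at_infinity sequentially"
    by (rule tendsto_add_filterlim_at_infinity[OF tendsto_const tendsto_of_nat])
  have "(\<lambda>n. 1 + (a - b) / (b + of_nat n)) \<longlonglongrightarrow> 1 + 0"
    by (intro tendsto_intros tendsto_divide_0[OF tendsto_const inf])
  moreover have "eventually (\<lambda>n. b + of_nat n \<noteq> 0) sequentially"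
    using filterlim_at_infinity_imp_eventually_ne[OF inf, of 0] .
  hence "eventually (\<lambda>n. 1 + (a - b) / (b + of_nat n) = (a + of_nat n) / (b + of_nat n)) sequentially"
    by eventually_elim (simp add: field_simps)
  ultimately show ?thesis by (simp add: tendsto_cong)
qed

text \<open>
  Consecutive terms have a quotient that tends to \<open>q\<close>, so the ratio test applies. If \<open>b\<close> is a
  non-positive integer, the quotients are eventually 0 by the convention \<open>x / 0 = 0\<close>.
\<close>

lemma pochhammer_ratio_geometric_tendsto_0:
  fixes a b q :: complex
  assumes q: "norm q < 1"
  shows "(\<lambda>n. pochhammer a n / pochhammer b n * q ^ n) \<longlonglongrightarrow> 0"
proof -
  define f where "f = (\<lambda>n. pochhammer a n / pochhammer b n * q ^ n)"
  define c where "c = (1 + norm q) / 2"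
  have c: "c < 1" "norm q < c" using q by (auto simp: c_def)
  have "(\<lambda>n. norm ((a + of_nat n) / (b + of_nat n) * q)) \<longlonglongrightarrow> norm (1 * q)"
    by (intro tendsto_intros quotient_of_nat_tendsto_1)
  hence "eventually (\<lambda>n. norm ((a + of_nat n) / (b + of_nat n) * q) < c) sequentially"
    using c by (intro order_tendstoD) auto
  then obtain N where N: "norm ((a + of_nat n) / (b + of_nat n) * q) < c" if "n \<ge> N" for n
    by (auto simp: eventually_sequentially)
  have "norm (f (Suc n)) \<le> c * norm (f n)" if "n \<ge> N" for n
  proof -
    have f_Suc: "f (Suc n) = (a + of_nat n) / (b + of_nat n) * q * f n"
      by (simp add: f_def pochhammer_Suc mult_ac)
    show ?thesis
      unfolding f_Suc norm_mult[of _ "f n"] by (intro mult_right_mono less_imp_le[OF N[OF that]]) simp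
  qed
  hence "summable f" by (rule summable_ratio_test[OF c(1)])
  thus ?thesis unfolding f_def by (rule summable_LIMSEQ_zero)
qed

lemma power_times_geometric_tendsto_0:
  "(\<lambda>n. of_nat n ^ j * (1/2) ^ n :: complex) \<longlonglongrightarrow> 0"
proof (rule tendsto_norm_zero_cancel)
  have "(\<lambda>n. real n ^ j * (1/2) ^ n) \<longlonglongrightarrow> 0" by real_asymp
  thus "(\<lambda>n. norm (of_nat n ^ j * (1/2) ^ n :: complex)) \<longlonglongrightarrow> 0"
    by (simp add: norm_mult norm_power norm_divide)
qed

lemma wz_poly_geometric_tendsto_0: "(\<lambda>n. wz_poly (of_nat n) k * (1/2) ^ n) \<longlonglongrightarrow> 0"
proof -
  note m = power_times_geometric_tendsto_0
  have "(\<lambda>n. 168*(of_nat n^5 * (1/2)^n) + (228 + 808*k)*(of_nat n^4 * (1/2)^n)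
     + (-84 + 48*k + 592*k^2)*(of_nat n^3 * (1/2)^n)
     - (186 + 1436*k + 3400*k^2 + 2544*k^3)*(of_nat n^2 * (1/2)^n)
     - (91/2 + 764*k + 3724*k^2 + 7184*k^3 + 4856*k^4)*(of_nat n^1 * (1/2)^n)
     - (15/4 + 167/2*k + 706*k^2 + 2532*k^3 + 4028*k^4 + 2360*k^5)*(of_nat n^0 * (1/2)^n))
     \<longlonglongrightarrow> 168*0 + (228 + 808*k)*0 + (-84 + 48*k + 592*k^2)*0
     - (186 + 1436*k + 3400*k^2 + 2544*k^3)*0
     - (91/2 + 764*k + 3724*k^2 + 7184*k^3 + 4856*k^4)*0
     - (15/4 + 167/2*k + 706*k^2 + 2532*k^3 + 4028*k^4 + 2360*k^5)*0"
    by (intro tendsto_diff tendsto_add tendsto_mult_left m)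
  moreover have "(\<lambda>n. wz_poly (of_nat n) k * (1/2) ^ n) =
    (\<lambda>n. 168*(of_nat n^5 * (1/2)^n) + (228 + 808*k)*(of_nat n^4 * (1/2)^n)
     + (-84 + 48*k + 592*k^2)*(of_nat n^3 * (1/2)^n)
     - (186 + 1436*k + 3400*k^2 + 2544*k^3)*(of_nat n^2 * (1/2)^n)
     - (91/2 + 764*k + 3724*k^2 + 7184*k^3 + 4856*k^4)*(of_nat n^1 * (1/2)^n)
     - (15/4 + 167/2*k + 706*k^2 + 2532*k^3 + 4028*k^4 + 2360*k^5)*(of_nat n^0 * (1/2)^n))"
    unfolding wz_poly_def
    by (intro ext)
       (simp only: ring_distribs mult_ac power_one_right power_0 mult_1_right mult_1_left)
  ultimately show ?thesis by simp
qed

text \<open>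
  The decay of \<open>(1/64)^n\<close> is shared out: a factor \<open>(5/8)^n\<close> for each of the seven quotients of
  shifted factorials, a factor \<open>(1/2)^n\<close> for the polynomial, and the rest, \<open>t^n\<close> with
  \<open>t < 1\<close>, because \<open>(5/8)^7 > 1/32\<close>.
\<close>

lemma wz_mate_tendsto_0: "wz_mate k \<longlonglongrightarrow> 0"
proof -
  define K where "K = term_prefactor k / (k + 1/2)^2"
  define t :: complex where "t = (1/32) / (5/8)^7"
  define R where "R = (\<lambda>a b n. pochhammer a n / pochhammer b n * (5/8 :: complex) ^ n)"
  have t: "norm t < 1" by (simp add: t_def norm_divide norm_power field_simps)
  have R: "R a b \<longlonglongrightarrow> 0" for a b
    unfolding R_def by (rule pochhammer_ratio_geometric_tendsto_0) (simp add: norm_divide)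
  have "(\<lambda>n. K * (R (1/2+3*k) (1+2*k) n ^ 2 * R (-1/2-k) 1 n ^ 2 * R (1/2+k) (1+k) n ^ 3) * t ^ n
           * ((0 + of_nat n) / (2*k + 1 + of_nat n)) ^ 2 * (wz_poly (of_nat n) k * (1/2) ^ n))
        \<longlonglongrightarrow> K * (0^2 * 0^2 * 0^3) * 0 * 1^2 * 0"
    by (intro tendsto_intros R LIMSEQ_power_zero[OF t] quotient_of_nat_tendsto_1
         wz_poly_geometric_tendsto_0)
  also have "(\<lambda>n. K * (R (1/2+3*k) (1+2*k) n ^ 2 * R (-1/2-k) 1 n ^ 2 * R (1/2+k) (1+k) n ^ 3) * t ^ n
           * ((0 + of_nat n) / (2*k + 1 + of_nat n)) ^ 2 * (wz_poly (of_nat n) k * (1/2) ^ n)) = wz_mate k"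
  proof
    fix n
    have "((5/8)^n)^7 * t^n * (1/2)^n = ((5/8)^7 * t * (1/2) :: complex)^n"
      by (simp only: power_mult_distrib power_mult[symmetric] mult.commute)
    also have "(5/8)^7 * t * (1/2) = 1/64" by (simp add: t_def)
    finally have e: "(1/64)^n = ((5/8)^n)^7 * t^n * (1/2)^n" ..
    have gen: "P / h^2 * ((a1/b1*q)^2 * (a2/b2*q)^2 * (a3/b3*q)^3) * s * (N/D)^2 * (Q * w)
       = P * (a1^2 * a2^2 * a3^3) / (b2^2 * b1^2 * b3^3) * (q^7 * s * w) / h^2 * (N^2 * Q / D^2)"
      for P h a1 a2 a3 b1 b2 b3 q s N D Q w :: complex
      by (simp add: power_mult_distrib power_divide eval_nat_numeral mult_ac)
    have c: "of_nat n + 2*k + 1 = 2*k + 1 + of_nat n" by simp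
    show "K * (R (1/2+3*k) (1+2*k) n ^ 2 * R (-1/2-k) 1 n ^ 2 * R (1/2+k) (1+k) n ^ 3) * t ^ n
           * ((0 + of_nat n) / (2*k + 1 + of_nat n)) ^ 2 * (wz_poly (of_nat n) k * (1/2) ^ n) = wz_mate k n"
      unfolding wz_mate_def wz_base_def K_def R_def e c add_0_left by (rule gen)
  qed
  finally show ?thesis by simp
qed

text \<open>
  Convergence is transported from \<open>k + 1\<close> down to \<open>k\<close>. Therefore estimates are needed only
  in the right half-plane.
\<close>

lemma series_term_sums_shift:
  assumes adm: "admissible k" and s: "series_term (k + 1) sums s"
  shows "series_term k sums s"
proof -
  have "(\<lambda>n. wz_mate k (Suc n) - wz_mate k n) sums (0 - wz_mate k 0)"
    by (rule telescope_sums[OF wz_mate_tendsto_0])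
  hence "(\<lambda>n. series_term (k + 1) n - series_term k n) sums 0"
    by (simp add: wz_pair[OF adm]) (simp add: wz_mate_def)
  from sums_diff[OF s this] show ?thesis by simp
qed

lemma series_term_sums_shift_nat:
  assumes "admissible k" "series_term (k + of_nat m) sums s"
  shows "series_term k sums s"
  using assms
proof (induction m arbitrary: k)
  case (Suc m)
  have "k + of_nat (Suc m) = k + 1 + of_nat m" by simp
  hence "series_term (k + 1 + of_nat m) sums s" using Suc.prems(2) by metis
  with Suc.IH Suc.prems(1) have "series_term (k + 1) sums s" using admissible_plus_1 by blast
  thus ?case using series_term_sums_shift Suc.prems(1) by blast
qed simp

section \<open>Bounds in the right half-plane\<close>

lemma norm_le_componentwise:
  assumes "\<bar>Re a\<bar> \<le> \<bar>Re b\<bar>" "\<bar>Im a\<bar> \<le> \<bar>Im b\<bar>"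
  shows "norm a \<le> norm b"
  using assms unfolding cmod_def
  by (intro real_sqrt_le_mono add_mono) (simp_all flip: abs_le_square_iff)

lemma norm_pochhammer_le:
  fixes a b :: complex
  assumes "\<And>j. norm (a + of_nat j) \<le> C * norm (b + of_nat j)"
  shows "norm (pochhammer a n) \<le> C ^ n * norm (pochhammer b n)"
proof (induction n)
  case (Suc n)
  have "norm (pochhammer a n) * norm (a + of_nat n)
     \<le> (C ^ n * norm (pochhammer b n)) * (C * norm (b + of_nat n))"
    using order_trans[OF norm_ge_zero Suc] by (intro mult_mono assms Suc) auto
  thus ?case by (simp add: pochhammer_Suc norm_mult mult_ac)
qed simp

text \<open>
  With \<open>m\<close> the integer part of \<open>\<bar>a\<bar>\<close>, each factor is at most the corresponding factor of
  \<open>(m + 1)\<^sub>n = n! * ((m + n) choose n) \<le> n! * 2^(m + n)\<close>. The exponential rate \<open>ln 2\<close> in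
  \<open>\<bar>a\<bar>\<close> is what decides whether the growth of the sum stays below \<open>exp(\<pi> \<bar>Im k\<bar>)\<close>.
\<close>

lemma norm_pochhammer_le_fact:
  fixes a :: complex
  shows "norm (pochhammer a n) \<le> fact n * 2 ^ n * 2 powr norm a"
proof -
  define m where "m = nat \<lfloor>norm a\<rfloor>"
  have m: "norm a \<le> 1 + real m" "real m \<le> norm a" unfolding m_def using of_nat_floor[of "norm a"] by simp_all linarith
  have "norm (a + of_nat j) \<le> 1 * norm (1 + of_nat m + of_nat j :: complex)" for j
  proof -
    have "norm (a + of_nat j) \<le> norm a + real j" by (metis norm_of_nat norm_triangle_ineq)
    also have "\<dots> \<le> real (1 + m + j)" using m(1) by simp
    also have "\<dots> = norm (of_nat (1 + m + j) :: complex)" by (rule norm_of_nat[symmetric])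
    finally show ?thesis by (simp add: add_ac)
  qed
  from norm_pochhammer_le[OF this, of n]
  have "norm (pochhammer a n) \<le> norm (pochhammer (1 + of_nat m :: complex) n)" by simp
  also have "\<dots> = fact (m + n) / fact m"
  proof -
    have "fact (m + n) = fact m * pochhammer (1 + of_nat m :: complex) n"
      unfolding pochhammer_fact pochhammer_product' ..
    hence "pochhammer (1 + of_nat m :: complex) n = fact (m + n) / fact m" by (simp add: field_simps)
    thus ?thesis by (simp add: norm_divide)
  qed
  also have "\<dots> = fact n * real ((m + n) choose n)"
    using binomial_fact[of n "m + n", where 'a = real] by simp
  also have "real ((m + n) choose n) \<le> 2 ^ (m + n)"
    using binomial_le_pow2[of "m + n" n] by (metis of_nat_le_iff of_nat_numeral of_nat_power)
  also have "(2::real) ^ (m + n) = 2 ^ n * 2 powr real m"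
    by (simp add: power_add powr_realpow)
  also have "2 powr real m \<le> 2 powr norm a" using m(2) by simp
  finally show ?thesis by (simp add: mult_ac)
qed

lemma norm_weight_le:
  "norm (weight (of_nat n) k) \<le> 168 * (1 + norm k) ^ 3 * (real n + 1) ^ 3"
proof -
  define x y where "x = real n" and "y = norm k"
  have xy: "x \<ge> 0" "y \<ge> 0" "x * y \<ge> 0" "x^2*y \<ge> 0" "x*y^2 \<ge> 0" "x^2*y^2 \<ge> 0" "x^2 \<ge> 0" "y^2 \<ge> 0"
    by (auto simp: x_def y_def)
  have "norm (6 * of_nat n + 6 * k + 1) \<le> 6 * x + 6 * y + 1"
    unfolding x_def y_def
    by (intro order_trans[OF norm_triangle_ineq] add_mono) (auto simp: norm_mult)
  also have "\<dots> \<le> 6 * ((1 + y) * (x + 1))" using xy by (simp add: algebra_simps)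
  finally have 1: "norm (6 * of_nat n + 6 * k + 1) \<le> 6 * ((1 + y) * (x + 1))" .
  have "norm (28 * of_nat n^2 + 8 * of_nat n + 1 + 12 * k^2 + 56 * of_nat n * k + 8 * k)
      \<le> 28 * x^2 + 8 * x + 1 + 12 * y^2 + 56 * x * y + 8 * y"
    unfolding x_def y_def
    by (intro order_trans[OF norm_triangle_ineq] add_mono) (auto simp: norm_mult norm_power)
  also have "\<dots> \<le> 28 * ((1 + y)^2 * (x + 1)^2)"
    using xy by (simp add: algebra_simps power2_eq_square)
  finally have 2: "norm (28 * of_nat n^2 + 8 * of_nat n + 1 + 12 * k^2 + 56 * of_nat n * k + 8 * k)
      \<le> 28 * ((1 + y)^2 * (x + 1)^2)" .
  have "norm (weight (of_nat n) k) \<le> 6 * ((1 + y) * (x + 1)) * (28 * ((1 + y)^2 * (x + 1)^2))"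
    unfolding weight_def norm_mult by (intro mult_mono 1 2) (use xy in auto)
  also have "\<dots> = 168 * (1 + y)^3 * (x + 1)^3"
    by algebra
  finally show ?thesis by (simp add: x_def y_def)
qed

definition tail_bound :: "nat \<Rightarrow> real" where
  "tail_bound n = (real n + 1) ^ 3 * (9/64) ^ n"

lemma summable_tail_bound: "summable tail_bound"
proof -
  have "(\<lambda>n. (real n + 1) ^ 3 * (9/64) ^ n) \<in> O(\<lambda>n. (1/2) ^ n)" by real_asymp
  thus ?thesis unfolding tail_bound_def
    by (rule summable_comparison_test_bigo[rotated]) simp
qed

definition growth_bound :: "real \<Rightarrow> real" where
  "growth_bound r = 168 * (1 + r) ^ 3 * (2 powr (1 + r)) ^ 2"

lemma growth_bound_mono: "0 \<le> r \<Longrightarrow> r \<le> s \<Longrightarrow> growth_bound r \<le> growth_bound s"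
  unfolding growth_bound_def by (intro mult_mono power_mono) auto

text \<open>
  For \<open>Re k > 0\<close> the symbols in numerator and denominator are compared factor by factor:
  \<open>(1/2 + 3k)\<^sub>n\<close> with \<open>(1 + 2k)\<^sub>n\<close> costs \<open>(3/2)^n\<close>, and \<open>(1/2 + k)\<^sub>n\<close> with \<open>(1 + k)\<^sub>n\<close>
  costs nothing. Only \<open>(1/2 - k)\<^sub>n\<close> against \<open>n!\<close> produces growth in \<open>k\<close>, at the price of
  \<open>2^n\<close>. Altogether the geometric rate is \<open>(3/2)\<^sup>2 * 2\<^sup>2 / 64 = 9/64\<close>.
\<close>

lemma norm_hyper_term_le:
  assumes k: "Re k > 0"
  shows "norm (hyper_term k n) \<le> growth_bound (norm k) * tail_bound n"
proof -
  note adm = admissible_Re_pos[OF k]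
  define d e f where "d = norm (pochhammer (1 :: complex) n)"
    and "e = norm (pochhammer (1 + 2*k) n)" and "f = norm (pochhammer (1 + k) n)"
  have pos: "d > 0" "e > 0" "f > 0"
    using admissible_pochhammer_nonzero[OF adm, of n]
    by (simp_all add: d_def e_def f_def pochhammer_fact[symmetric])
  define w where "w = 2 powr (1 + norm k)"
  have a: "norm (pochhammer (1/2 + 3*k) n) \<le> (3/2)^n * e"
    unfolding e_def
  proof (rule norm_pochhammer_le)
    fix j
    have "norm (1/2 + 3*k + of_nat j) \<le> norm (of_real (3/2) * (1 + 2*k + of_nat j))"
      by (rule norm_le_componentwise) (use k in simp_all)
    thus "norm (1/2 + 3*k + of_nat j) \<le> 3/2 * norm (1 + 2*k + of_nat j)"
      unfolding norm_mult by simp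
  qed
  have b: "norm (pochhammer (1/2 - k) n) \<le> d * 2 ^ n * w"
  proof -
    have "norm (1/2 - k) \<le> 1 + norm k"
      using norm_triangle_ineq4[of "1/2" k] by (simp add: norm_divide)
    hence "fact n * 2 ^ n * 2 powr norm (1/2 - k) \<le> fact n * 2 ^ n * w"
      unfolding w_def by (intro mult_left_mono powr_mono) auto
    with norm_pochhammer_le_fact[of "1/2 - k" n]
    have "norm (pochhammer (1/2 - k) n) \<le> fact n * 2 ^ n * w" by (rule order_trans)
    thus ?thesis by (simp add: d_def pochhammer_fact[symmetric])
  qed
  have c: "norm (pochhammer (1/2 + k) n) \<le> 1 ^ n * f"
    unfolding f_def
  proof (rule norm_pochhammer_le)
    fix j show "norm (1/2 + k + of_nat j) \<le> 1 * norm (1 + k + of_nat j)"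
      unfolding mult_1_left by (rule norm_le_componentwise) (use k in simp_all)
  qed
  have "norm (hyper_term k n) = norm (pochhammer (1/2 + 3*k) n) ^ 2 * norm (pochhammer (1/2 - k) n) ^ 2
      * norm (pochhammer (1/2 + k) n) ^ 3 / (d^2 * e^2 * f^3) * (1/64) ^ n * norm (weight (of_nat n) k)"
    by (simp add: hyper_term_def norm_mult norm_divide norm_power d_def e_def f_def)
  also have "\<dots> \<le> ((3/2)^n * e)^2 * (d * 2^n * w)^2 * f^3 / (d^2 * e^2 * f^3) * (1/64)^n
      * (168 * (1 + norm k) ^ 3 * (real n + 1) ^ 3)"
    using pos a b c
    by (intro mult_mono divide_right_mono power_mono norm_weight_le) (auto simp: w_def)
  also have "\<dots> = (((3/2)^n)^2 * (2^n)^2 * (1/64)^n) * (w^2 * 168 * (1 + norm k) ^ 3 * (real n + 1) ^ 3)"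
    using pos by (simp add: power_mult_distrib field_simps)
  also have "((3/2)^n)^2 * (2^n)^2 * (1/64)^n = ((3/2)^2 * 2^2 * (1/64) :: real)^n"
    by (simp only: power_mult_distrib power_mult[symmetric] mult.commute)
  also have "\<dots> = (9/64)^n" by (simp add: power2_eq_square)
  finally show ?thesis by (simp add: growth_bound_def tail_bound_def w_def mult_ac)
qed

section \<open>Periodic entire functions of small exponential type\<close>

lemma norm_cos_ge_exp:
  fixes z :: complex assumes "\<bar>Im z\<bar> \<ge> 1"
  shows "norm (cos z) \<ge> exp \<bar>Im z\<bar> / 4"
proof -
  have a: "norm (exp (\<i> * z)) = exp (- Im z)" "norm (exp (- (\<i> * z))) = exp (Im z)"
    by simp_all
  have n: "norm (cos z) = norm (exp (\<i> * z) + exp (- (\<i> * z))) / 2"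
    by (simp add: cos_exp_eq norm_divide)
  have "norm (exp (\<i> * z) + exp (- (\<i> * z))) \<ge> \<bar>exp (- Im z) - exp (Im z)\<bar>"
    using norm_triangle_ineq3[of "exp (\<i> * z)" "- exp (- (\<i> * z))"] a by simp
  moreover have "\<bar>exp (- Im z) - exp (Im z)\<bar> = exp \<bar>Im z\<bar> - exp (- \<bar>Im z\<bar>)"
    by (cases "Im z \<ge> 0") auto
  ultimately have 1: "norm (cos z) \<ge> (exp \<bar>Im z\<bar> - exp (- \<bar>Im z\<bar>)) / 2" using n by simp
  have "exp \<bar>Im z\<bar> \<ge> 2" using exp_ge_add_one_self[of "\<bar>Im z\<bar>"] assms by linarith
  moreover have "exp (- \<bar>Im z\<bar>) \<le> 1" by simp
  moreover have "E / 4 \<le> (E - e) / 2" if "E \<ge> 2" "e \<le> 1" for E e :: real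
    using that by (simp add: field_simps)
  ultimately show ?thesis using 1 by (meson order_trans)
qed

lemma cos_pi_eq_0_iff:
  fixes z :: complex
  shows "cos (pi * z) = 0 \<longleftrightarrow> (\<exists>j::int. z = of_int j + 1/2)"
proof -
  have "cos (pi * z) = 0 \<longleftrightarrow> (\<exists>j::int. of_real pi * z = of_int j * of_real pi + of_real pi / 2)"
    by (simp add: cos_eq_0)
  also have "\<dots> \<longleftrightarrow> (\<exists>j::int. z = of_int j + 1/2)"
  proof (intro ex_cong1)
    fix j :: int
    have "of_int j * of_real pi + of_real pi / 2 = complex_of_real pi * (of_int j + 1/2)"
      by (simp add: algebra_simps)
    thus "(of_real pi * z = of_int j * of_real pi + of_real pi / 2) = (z = of_int j + 1/2)"
      by simp
  qed
  finally show ?thesis .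
qed

lemma periodic_of_int:
  fixes f :: "complex \<Rightarrow> 'a"
  assumes "\<And>z. f (z + 1) = f z"
  shows "f (z + of_int j) = f z"
proof -
  have nat: "f (z + of_nat m) = f z" for z m
  proof (induction m)
    case (Suc m)
    have "z + of_nat (Suc m) = z + of_nat m + 1" by simp
    thus ?case using assms Suc by metis
  qed simp
  show ?thesis
  proof (cases "j \<ge> 0")
    case True
    thus ?thesis using nat[of z "nat j"] by simp
  next
    case False
    thus ?thesis using nat[of "z + of_int j" "nat (-j)"] by simp
  qed
qed

text \<open>
  Near a common zero both functions are divided by \<open>z - z0\<close>; the resulting quotient is
  holomorphic since the zero of the denominator is simple.
\<close>

lemma holomorphic_divide_simple_zeros:
  fixes g c :: "complex \<Rightarrow> complex"
  assumes g: "g holomorphic_on UNIV" and c: "c holomorphic_on UNIV"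
    and zero: "\<And>z. c z = 0 \<Longrightarrow> g z = 0" and simple: "\<And>z. c z = 0 \<Longrightarrow> deriv c z \<noteq> 0"
  shows "(\<lambda>z. if c z = 0 then deriv g z / deriv c z else g z / c z) holomorphic_on UNIV"
    (is "?T holomorphic_on UNIV")
proof -
  have "?T field_differentiable at z0" for z0
  proof (cases "c z0 = 0")
    case False
    have op: "open {z. c z \<noteq> 0}"
      using holomorphic_on_imp_continuous_on[OF c] by (intro open_Collect_neq) auto
    have "(\<lambda>z. g z / c z) holomorphic_on {z. c z \<noteq> 0}"
      by (intro holomorphic_intros holomorphic_on_subset[OF g] holomorphic_on_subset[OF c]) auto
    hence "?T holomorphic_on {z. c z \<noteq> 0}"
      by (rule holomorphic_transform) auto
    thus ?thesis using op False by (auto simp: holomorphic_on_open field_differentiable_def)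
  next
    case True
    define G where "G = (\<lambda>z. if z = z0 then deriv g z0 else (g z - g z0) / (z - z0))"
    define C where "C = (\<lambda>z. if z = z0 then deriv c z0 else (c z - c z0) / (z - z0))"
    have GC: "G holomorphic_on UNIV" "C holomorphic_on UNIV"
      unfolding G_def C_def using g c by (auto intro!: pole_lemma)
    have op: "open {z. C z \<noteq> 0}"
      using holomorphic_on_imp_continuous_on[OF GC(2)] by (intro open_Collect_neq) auto
    have "(\<lambda>z. G z / C z) holomorphic_on {z. C z \<noteq> 0}"
      by (intro holomorphic_intros holomorphic_on_subset[OF GC(1)] holomorphic_on_subset[OF GC(2)]) auto
    hence "?T holomorphic_on {z. C z \<noteq> 0}"
      by (rule holomorphic_transform) (use True zero[OF True] in \<open>auto simp: G_def C_def\<close>)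
    moreover have "C z0 \<noteq> 0" using simple[OF True] by (simp add: C_def)
    ultimately show ?thesis using op by (auto simp: holomorphic_on_open field_differentiable_def)
  qed
  thus ?thesis by (auto simp: holomorphic_on_def field_differentiable_at_within)
qed

text \<open>
  The difference \<open>f(z) - f(1/2)\<close> vanishes at all zeros of \<open>cos(\<pi> z)\<close>, so the quotient \<open>T\<close> of the
  two is entire. It is bounded by the growth condition, hence constant by Liouville's theorem.
  As \<open>cos(\<pi> z)\<close> changes sign under \<open>z \<mapsto> z + 1\<close>, so does \<open>T\<close>, and the constant is 0.
\<close>

theorem periodic_entire_constant:
  fixes f :: "complex \<Rightarrow> complex"
  assumes hol: "f holomorphic_on UNIV" and per: "\<And>z. f (z + 1) = f z"
    and growth: "\<And>z. norm (f z) \<le> M * exp (pi * \<bar>Im z\<bar>)"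
  shows "f z = f (1/2)"
proof -
  define g where "g = (\<lambda>z. f z - f (1/2))"
  define c :: "complex \<Rightarrow> complex" where "c = (\<lambda>z::complex. cos (of_real pi * z))"
  define T where "T = (\<lambda>z. if c z = 0 then deriv g z / deriv c z else g z / c z)"
  have g_hol: "g holomorphic_on UNIV" unfolding g_def by (intro holomorphic_intros hol)
  have c_hol: "c holomorphic_on UNIV" unfolding c_def by (intro holomorphic_intros)
  have g_per: "g (z + 1) = g z" for z by (simp add: g_def per)
  have c_anti: "c (z + 1) = - c z" for z by (simp add: c_def ring_distribs cos_add)
  have g_zero: "g z = 0" if "c z = 0" for z
  proof -
    from that obtain j where "z = of_int j + 1/2" by (auto simp: c_def cos_pi_eq_0_iff)
    thus ?thesis using periodic_of_int[of f "1/2" j, OF per] by (simp add: g_def add_ac)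
  qed
  have dc: "deriv c z = - (of_real pi * sin (of_real pi * z))" for z :: complex
    unfolding c_def by (rule DERIV_imp_deriv) (auto intro!: derivative_eq_intros)
  have c_simple: "deriv c z \<noteq> 0" if "c z = 0" for z
  proof
    assume "deriv c z = 0"
    hence "sin (of_real pi * z) = 0" by (simp add: dc)
    with that show False using sin_cos_squared_add[of "of_real pi * z"] by (simp add: c_def)
  qed
  have T_hol: "T holomorphic_on UNIV"
    unfolding T_def by (intro holomorphic_divide_simple_zeros g_hol c_hol g_zero c_simple)
  have T_anti: "T (z + 1) = - T z" for z
  proof -
    have "deriv g (z + 1) = deriv g z"
      using DERIV_shift[of g _ z 1] by (simp add: deriv_def g_per)
    thus ?thesis by (simp add: T_def c_anti g_per dc ring_distribs sin_add)
  qed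
  have M: "M \<ge> 0" using order_trans[OF norm_ge_zero growth[of 0]] by simp
  have "bounded (range T)"
  proof -
    have "compact (T ` cbox (Complex 0 (-1)) (Complex 1 1))"
      by (intro compact_continuous_image compact_cbox
          continuous_on_subset[OF holomorphic_on_imp_continuous_on[OF T_hol]]) auto
    then obtain B where B: "norm (T z) \<le> B" if "z \<in> cbox (Complex 0 (-1)) (Complex 1 1)" for z
      by (meson compact_imp_bounded bounded_iff imageI)
    have "norm (T z) \<le> max B (4 * (M + norm (f (1/2))))" for z
    proof (cases "\<bar>Im z\<bar> \<ge> 1")
      case True
      have "1 * 1 \<le> pi * \<bar>Im z\<bar>"
        using pi_ge_two True by (intro mult_mono) auto
      hence y: "\<bar>Im (pi * z)\<bar> = pi * \<bar>Im z\<bar>" "pi * \<bar>Im z\<bar> \<ge> 1"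
        by (simp_all add: abs_mult)
      have c: "norm (c z) \<ge> exp (pi * \<bar>Im z\<bar>) / 4"
        using norm_cos_ge_exp[of "pi * z"] y by (simp add: c_def)
      have "0 < exp (pi * \<bar>Im z\<bar>) / 4" by simp
      hence "0 < norm (c z)" using c by (rule less_le_trans)
      hence c0: "c z \<noteq> 0" by simp
      have "norm (g z) \<le> norm (f z) + norm (f (1/2))"
        unfolding g_def by (rule norm_triangle_ineq4)
      also have "\<dots> \<le> M * exp (pi * \<bar>Im z\<bar>) + norm (f (1/2)) * exp (pi * \<bar>Im z\<bar>)"
        using mult_left_mono[of 1 "exp (pi * \<bar>Im z\<bar>)" "norm (f (1/2))"]
        by (intro add_mono growth) simp
      also have "\<dots> = 4 * (M + norm (f (1/2))) * (exp (pi * \<bar>Im z\<bar>) / 4)"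
        by (simp add: algebra_simps)
      also have "\<dots> \<le> 4 * (M + norm (f (1/2))) * norm (c z)"
        by (intro mult_left_mono c) (use M in simp)
      finally have "norm (g z) / norm (c z) \<le> 4 * (M + norm (f (1/2)))"
        using c0 by (simp add: pos_divide_le_eq)
      thus ?thesis using c0 by (simp add: T_def norm_divide le_max_iff_disj)
    next
      case False
      have "norm (T (z + of_int (- \<lfloor>Re z\<rfloor>))) = norm (T z)"
        using periodic_of_int[of "\<lambda>z. norm (T z)" z "- \<lfloor>Re z\<rfloor>"] by (simp add: T_anti)
      moreover have "norm (T (z + of_int (- \<lfloor>Re z\<rfloor>))) \<le> B"
      proof (rule B)
        have "0 \<le> Re z - of_int \<lfloor>Re z\<rfloor>" "Re z - of_int \<lfloor>Re z\<rfloor> \<le> 1" by linarith+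
        moreover have "-1 \<le> Im z" "Im z \<le> 1" using False by linarith+
        ultimately show "z + of_int (- \<lfloor>Re z\<rfloor>) \<in> cbox (Complex 0 (-1)) (Complex 1 1)"
          by (simp add: in_cbox_complex_iff)
      qed
      ultimately show ?thesis by (metis max.coboundedI1)
    qed
    thus ?thesis by (intro boundedI) auto
  qed
  from Liouville_theorem[OF T_hol this] obtain t where t: "T z = t" for z
    by (auto simp: constant_on_def)
  have "t = 0" using T_anti[of 0] by (simp add: t)
  hence "c z \<noteq> 0 \<Longrightarrow> g z / c z = 0" using t[of z] by (simp add: T_def)
  hence "g z = 0" using g_zero[of z] by (cases "c z = 0") auto
  thus ?thesis by (simp add: g_def)
qed

section \<open>The Gamma prefactor\<close>

lemma norm_pochhammer_product_le:
  fixes a b c d :: complex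
  assumes "\<And>j. norm (a + of_nat j) * norm (b + of_nat j) \<le> norm (c + of_nat j) * norm (d + of_nat j)"
  shows "norm (pochhammer a n) * norm (pochhammer b n) \<le> norm (pochhammer c n) * norm (pochhammer d n)"
proof (induction n)
  case (Suc n)
  have "(norm (pochhammer a n) * norm (pochhammer b n)) * (norm (a + of_nat n) * norm (b + of_nat n))
     \<le> (norm (pochhammer c n) * norm (pochhammer d n)) * (norm (c + of_nat n) * norm (d + of_nat n))"
    by (intro mult_mono Suc assms) auto
  thus ?case by (simp add: pochhammer_Suc norm_mult mult_ac)
qed simp

text \<open>
  The inequality holds already for the approximants in Gauss's product. There the powers of
  \<open>n\<close> agree on both sides, and the shifted factorials compare factor by factor because
  \<open>\<bar>1 + t k\<bar>\<close> increases with \<open>t \<ge> 0\<close> when \<open>Re k \<ge> 0\<close>.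
\<close>

lemma norm_Gamma_product_le:
  fixes a :: real and k :: complex
  assumes a: "0 < a" "a \<le> 1" and k: "Re k \<ge> 0"
  shows "norm (Gamma (of_real a + k)) * norm (Gamma (1 :: complex))
           \<le> norm (Gamma (1 + k)) * norm (Gamma (of_real a :: complex))"
proof -
  have termwise: "norm (1 + k + of_nat j) * norm (of_real a + of_nat j :: complex)
       \<le> norm (of_real a + k + of_nat j) * norm (1 + of_nat j :: complex)" for j
  proof -
    have "norm ((1 + k + of_nat j) * of_real (a + real j))
        \<le> norm ((of_real a + k + of_nat j) * of_real (1 + real j))"
    proof (rule norm_le_componentwise)
      have "Re k * (a + real j) \<le> Re k * (1 + real j)"
        using k a by (intro mult_left_mono) auto
      hence "(1 + Re k + real j) * (a + real j) \<le> (a + Re k + real j) * (1 + real j)"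
        by (simp add: algebra_simps)
      thus "\<bar>Re ((1 + k + of_nat j) * of_real (a + real j))\<bar>
          \<le> \<bar>Re ((of_real a + k + of_nat j) * of_real (1 + real j))\<bar>"
        using k a by (simp add: abs_mult)
      show "\<bar>Im ((1 + k + of_nat j) * of_real (a + real j))\<bar>
          \<le> \<bar>Im ((of_real a + k + of_nat j) * of_real (1 + real j))\<bar>"
        using k a by (simp add: abs_mult mult_left_mono)
    qed
    thus ?thesis by (simp add: norm_mult)
  qed
  have "norm (Gamma_series (of_real a + k) n) * norm (Gamma_series (1 :: complex) n)
     \<le> norm (Gamma_series (1 + k) n) * norm (Gamma_series (of_real a :: complex) n)" for n
  proof -
    define F where "F = fact n * exp ((a + Re k) * ln (real n)) * (fact n * exp (ln (real n)))"
    have F': "F = fact n * exp ((1 + Re k) * ln (real n)) * (fact n * exp (a * ln (real n)))"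
      by (simp add: F_def mult_ac ring_distribs exp_add)
    have nz: "pochhammer z (n + 1) \<noteq> 0" if "Re z > 0" for z :: complex
    proof
      assume "pochhammer z (n + 1) = 0"
      then obtain j where "z = - of_nat j" by (auto simp: pochhammer_eq_0_iff)
      with that show False by simp
    qed
    have "F / (norm (pochhammer (of_real a + k) (n+1)) * norm (pochhammer (1 :: complex) (n+1)))
        \<le> F / (norm (pochhammer (1 + k) (n+1)) * norm (pochhammer (of_real a :: complex) (n+1)))"
      using norm_pochhammer_product_le[OF termwise, of "n+1"] nz k a
      by (intro divide_left_mono) (auto simp: F_def simp del: pochhammer_Suc)
    also have "F / (norm (pochhammer (1 + k) (n+1)) * norm (pochhammer (of_real a :: complex) (n+1)))
       = norm (Gamma_series (1 + k) n) * norm (Gamma_series (of_real a :: complex) n)"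
      unfolding F' by (simp add: Gamma_series_def norm_mult norm_divide)
    also have "F / (norm (pochhammer (of_real a + k) (n+1)) * norm (pochhammer (1 :: complex) (n+1)))
       = norm (Gamma_series (of_real a + k) n) * norm (Gamma_series (1 :: complex) n)"
      unfolding F_def by (simp add: Gamma_series_def norm_mult norm_divide)
    finally show ?thesis .
  qed
  thus ?thesis
    by (intro LIMSEQ_le[of "\<lambda>n. norm (Gamma_series (of_real a + k) n) * norm (Gamma_series (1 :: complex) n)"
              _ "\<lambda>n. norm (Gamma_series (1 + k) n) * norm (Gamma_series (of_real a :: complex) n)"]
         tendsto_intros Gamma_series_LIMSEQ) auto
qed

lemma norm_rising_le:
  fixes a :: real
  assumes a: "0 < a" "a \<le> 1" and k: "Re k \<ge> 0"
  shows "norm (rising (of_real a) k) \<le> norm (rising 1 k)"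
proof -
  have "Gamma (complex_of_real a) \<noteq> 0"
    using a by (simp add: Gamma_eq_zero_iff Re_pos_notin_nonpos_Ints)
  thus ?thesis
    using norm_Gamma_product_le[OF assms] by (simp add: rising_def norm_divide field_simps)
qed

text \<open>
  Numerator and denominator contain five rising factorials each, so that the exponential decay
  of the Gamma function in the vertical direction cancels and no growth is left.
\<close>

lemma norm_term_prefactor_le_1:
  assumes k: "Re k \<ge> 0"
  shows "norm (term_prefactor k) \<le> 1"
proof -
  have le: "norm (rising (1/2) k) \<le> norm (rising 1 k)" "norm (rising (1/6) k) \<le> norm (rising 1 k)"
     "norm (rising (5/6) k) \<le> norm (rising 1 k)"
    using norm_rising_le[of "1/2" k] norm_rising_le[of "1/6" k] norm_rising_le[of "5/6" k] k by auto
  have "norm (rising (1/2) k) * norm (rising (1/6) k)^2 * norm (rising (5/6) k)^2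
     \<le> norm (rising 1 k) * norm (rising 1 k)^2 * norm (rising 1 k)^2"
    by (intro mult_mono power_mono le) auto
  also have "\<dots> = norm (rising 1 k)^5" by (simp add: eval_nat_numeral)
  finally have "norm (rising (1/2) k) * norm (rising (1/6) k)^2 * norm (rising (5/6) k)^2
      / norm (rising 1 k)^5 \<le> 1"
    by (simp add: divide_le_eq_1)
  moreover have "norm (complex_of_real (729/1024) powr k) \<le> 1"
  proof -
    have "norm (complex_of_real (729/1024) powr k) = (729/1024) powr Re k"
      by (subst norm_powr_real_powr) auto
    also have "\<dots> \<le> 1" using k by (intro powr_le1) auto
    finally show ?thesis .
  qed
  ultimately show ?thesis
    unfolding term_prefactor_def norm_mult norm_divide norm_power by (intro mult_le_one) auto
qed

section \<open>The sum as a holomorphic function\<close>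

text \<open>
  The prefactor is kept outside the sum, so that the dominating series needs no local bound of
  the Gamma factors.
\<close>

definition series_value :: "complex \<Rightarrow> complex" where
  "series_value k = term_prefactor k * (\<Sum>n. hyper_term k n)"

lemma summable_hyper_term:
  assumes "Re k > 0" shows "summable (\<lambda>n. norm (hyper_term k n))"
  by (rule summable_comparison_test'[OF summable_mult[OF summable_tail_bound]])
     (use norm_hyper_term_le[OF assms] in simp)

lemma series_term_sums_series_value:
  assumes "Re k > 0" shows "series_term k sums series_value k"
  unfolding series_term_factor[abs_def] series_value_def
  by (intro sums_mult summable_sums summable_norm_cancel[OF summable_hyper_term[OF assms]])

lemma series_value_plus_nat:
  assumes "Re k > 0" shows "series_value (k + of_nat m) = series_value k"
proof -
  have "series_term k sums series_value (k + of_nat m)"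
    by (rule series_term_sums_shift_nat[OF admissible_Re_pos[OF assms]
          series_term_sums_series_value]) (use assms in simp)
  thus ?thesis using series_term_sums_series_value[OF assms] sums_unique2 by blast
qed

lemma norm_series_value_le:
  assumes "Re k > 0"
  shows "norm (series_value k) \<le> growth_bound (norm k) * suminf tail_bound"
proof -
  have "norm (series_value k) \<le> norm (\<Sum>n. hyper_term k n)"
    unfolding series_value_def norm_mult
    using norm_term_prefactor_le_1[of k] assms by (intro mult_left_le_one_le) auto
  also have "\<dots> \<le> (\<Sum>n. norm (hyper_term k n))"
    by (rule summable_norm[OF summable_hyper_term[OF assms]])
  also have "\<dots> \<le> (\<Sum>n. growth_bound (norm k) * tail_bound n)"
    by (intro suminf_le norm_hyper_term_le[OF assms] summable_hyper_term[OF assms]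
          summable_mult summable_tail_bound)
  also have "\<dots> = growth_bound (norm k) * suminf tail_bound"
    by (rule suminf_mult[OF summable_tail_bound])
  finally show ?thesis .
qed

lemma holomorphic_series_value: "series_value holomorphic_on {k. Re k > 0}"
proof -
  have op: "open {k. Re k > 0}" by (rule open_halfspace_Re_gt)
  have "hyper_term_sum holomorphic_on {k. Re k > 0}"
    if "hyper_term_sum = (\<lambda>k. \<Sum>n. hyper_term k n)" for hyper_term_sum
  proof (rule holomorphic_uniform_sequence[OF op])
    show "(\<lambda>k. \<Sum>i<n. hyper_term k i) holomorphic_on {k. Re k > 0}" for n
      unfolding hyper_term_def weight_def
      by (intro holomorphic_intros)
         (auto simp: admissible_pochhammer_nonzero admissible_Re_pos pochhammer_fact[symmetric])
    fix x assume x: "x \<in> {k. Re k > 0}"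
    then obtain d where d: "d > 0" "cball x d \<subseteq> {k. Re k > 0}"
      using op open_contains_cball by blast
    have "uniform_limit (cball x d) (\<lambda>n k. \<Sum>i<n. hyper_term k i) hyper_term_sum sequentially"
      unfolding that
    proof (rule Weierstrass_m_test)
      show "summable (\<lambda>n. growth_bound (norm x + d) * tail_bound n)"
        by (intro summable_mult summable_tail_bound)
      fix n k assume k: "k \<in> cball x d"
      have "norm k \<le> norm x + d"
        using k norm_triangle_sub[of k x] by (auto simp: dist_norm norm_minus_commute)
      hence "growth_bound (norm k) * tail_bound n \<le> growth_bound (norm x + d) * tail_bound n"
        by (intro mult_right_mono growth_bound_mono) (auto simp: tail_bound_def)
      moreover have "Re k > 0" using k d by auto
      ultimately show "norm (hyper_term k n) \<le> growth_bound (norm x + d) * tail_bound n"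
        using norm_hyper_term_le order_trans by blast
    qed
    thus "\<exists>d>0. cball x d \<subseteq> {k. Re k > 0} \<and>
        uniform_limit (cball x d) (\<lambda>n k. \<Sum>i<n. hyper_term k i) hyper_term_sum sequentially"
      using d by blast
  qed
  hence "(\<lambda>k. \<Sum>n. hyper_term k n) holomorphic_on {k. Re k > 0}" by blast
  moreover have "term_prefactor holomorphic_on {k. Re k > 0}"
    unfolding term_prefactor_def[abs_def] rising_def
    by (intro holomorphic_intros) (auto simp: Re_pos_notin_nonpos_Ints Gamma_eq_zero_iff)
  ultimately show ?thesis
    unfolding series_value_def[abs_def] by (intro holomorphic_intros)
qed

section \<open>The periodic entire extension\<close>

text \<open>
  Translating the argument into the strip \<open>0 < Re w \<le> 1\<close>, rather than just into the right
  half-plane, makes periodicity and the bound in terms of \<open>Im z\<close> immediate; holomorphy across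
  the edges of the strips comes from \<open>periodic_value_eq\<close>.
\<close>

definition periodic_value :: "complex \<Rightarrow> complex" where
  "periodic_value z = series_value (z - of_int (\<lceil>Re z\<rceil> - 1))"

lemma periodic_value_eq:
  assumes "Re z - of_int j > 0" shows "periodic_value z = series_value (z - of_int j)"
proof -
  define m where "m = \<lceil>Re z\<rceil> - 1"
  have le: "series_value (z - of_int i) = series_value (z - of_int l)"
    if "Re z - of_int l > 0" "i \<le> l" for i l
    using series_value_plus_nat[of "z - of_int l" "nat (l - i)"] that by simp
  have "Re z - of_int m > 0" unfolding m_def by linarith
  hence "series_value (z - of_int m) = series_value (z - of_int j)"
    using le[of j m] le[of m j, symmetric] assms linear[of m j] by blast
  thus ?thesis by (simp add: periodic_value_def m_def)
qed

lemma periodic_value_plus_1: "periodic_value (z + 1) = periodic_value z"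
proof -
  have "z + 1 - of_int (\<lceil>Re (z + 1)\<rceil> - 1) = z - of_int (\<lceil>Re z\<rceil> - 1)" by simp
  thus ?thesis unfolding periodic_value_def by (rule arg_cong)
qed

lemma holomorphic_periodic_value: "periodic_value holomorphic_on UNIV"
proof -
  have "periodic_value field_differentiable at z" for z
  proof -
    define j where "j = \<lceil>Re z\<rceil> - 1"
    let ?U = "{w. Re w > of_int j}"
    have "(series_value \<circ> (\<lambda>w. w - of_int j)) holomorphic_on ?U"
      by (intro holomorphic_on_compose holomorphic_intros
            holomorphic_on_subset[OF holomorphic_series_value]) auto
    hence "periodic_value holomorphic_on ?U"
      by (rule holomorphic_transform) (simp add: periodic_value_eq)
    moreover have "z \<in> ?U" by (simp add: j_def) linarith
    ultimately show ?thesis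
      using open_halfspace_Re_gt[of "of_int j"] by (auto simp: holomorphic_on_open field_differentiable_def)
  qed
  thus ?thesis by (auto simp: holomorphic_on_def field_differentiable_at_within)
qed

lemma growth_bound_le_exp:
  assumes y: "0 \<le> y"
  shows "growth_bound (1 + y) \<le> (168 * 6^3 * 16) * exp (pi * y)"
proof -
  \<comment> \<open>The cubic factor may cost \<open>exp (y / 2)\<close>: \<open>2 * ln 2 + 1/2 < 5/2 < \<pi>\<close>.\<close>
  have "2 + y \<le> 6 * exp (y / 6)"
    using exp_ge_add_one_self[of "y / 6"] y by linarith
  hence "(2 + y)^3 \<le> (6 * exp (y / 6))^3" using y by (intro power_mono) auto
  also have "\<dots> = 6^3 * exp (y / 2)"
    by (simp add: power_mult_distrib flip: exp_of_nat_mult)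
  finally have 1: "(2 + y)^3 \<le> 6^3 * exp (y / 2)" .
  have "2 powr y \<le> exp y"
    using y ln_2_less_1 mult_left_mono[of "ln 2" 1 y] by (simp add: powr_def)
  hence "(2 powr (2 + y))^2 \<le> (4 * exp y)^2"
    by (intro power_mono) (auto simp: powr_add)
  also have "\<dots> = 16 * exp (2 * y)"
    by (simp add: power_mult_distrib flip: exp_of_nat_mult)
  finally have 2: "(2 powr (2 + y))^2 \<le> 16 * exp (2 * y)" .
  have "growth_bound (1 + y) = 168 * (2 + y)^3 * (2 powr (2 + y))^2"
    by (simp add: growth_bound_def add.assoc[symmetric])
  also have "\<dots> \<le> 168 * (6^3 * exp (y / 2)) * (16 * exp (2 * y))"
    using y by (intro mult_mono 1 2) auto
  also have "\<dots> = (168 * 6^3 * 16) * exp (y / 2 + 2 * y)"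
    by (simp only: exp_add mult_ac)
  also have "\<dots> \<le> (168 * 6^3 * 16) * exp (pi * y)"
  proof -
    have "(5/2) * y \<le> pi * y" using y pi_gt3 by (intro mult_right_mono) auto
    thus ?thesis by (intro mult_left_mono) auto
  qed
  finally show ?thesis .
qed

lemma norm_periodic_value_le:
  "norm (periodic_value z) \<le> 168 * 6^3 * 16 * suminf tail_bound * exp (pi * \<bar>Im z\<bar>)"
proof -
  define w where "w = z - of_int (\<lceil>Re z\<rceil> - 1)"
  have w: "Re w > 0" "Re w \<le> 1" "Im w = Im z"
    unfolding w_def by (simp_all, linarith+)
  have nn: "suminf tail_bound \<ge> 0"
    by (intro suminf_nonneg summable_tail_bound) (simp add: tail_bound_def)
  have "norm w \<le> 1 + \<bar>Im z\<bar>" using cmod_le[of w] w by simp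
  hence "growth_bound (norm w) \<le> growth_bound (1 + \<bar>Im z\<bar>)" by (intro growth_bound_mono) auto
  also have "\<dots> \<le> (168 * 6^3 * 16) * exp (pi * \<bar>Im z\<bar>)" by (rule growth_bound_le_exp) simp
  finally have "growth_bound (norm w) * suminf tail_bound
      \<le> (168 * 6^3 * 16) * exp (pi * \<bar>Im z\<bar>) * suminf tail_bound"
    using nn by (rule mult_right_mono)
  with norm_series_value_le[OF w(1)] show ?thesis
    by (simp add: periodic_value_def w_def mult_ac)
qed

section \<open>The value of the sum\<close>

text \<open>
  At \<open>k = 1/2\<close> the symbol \<open>(1/2 - k)\<^sub>n = (0)\<^sub>n\<close> vanishes for \<open>n > 0\<close>. In the first term the Gamma
  values pair up as \<open>\<Gamma>(1/6) \<Gamma>(5/6) = 2\<pi>\<close> and \<open>\<Gamma>(1/3) \<Gamma>(2/3) = 2\<pi> / sqrt 3\<close>.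
\<close>

lemma series_value_half: "series_value (1/2) = 32 / of_real pi ^ 3"
proof -
  have h0: "hyper_term (1/2) n = 0" if "n \<noteq> 0" for n
    using that by (simp add: hyper_term_def pochhammer_0_left)
  have "(\<lambda>n. hyper_term (1/2) n) sums hyper_term (1/2) 0"
    using sums_finite[of "{0}" "hyper_term (1/2)"] h0 by simp
  hence "(\<Sum>n. hyper_term (1/2) n) = hyper_term (1/2) 0" by (simp add: sums_iff)
  also have "\<dots> = 32" by (simp add: hyper_term_def weight_def power2_eq_square)
  finally have sum: "(\<Sum>n. hyper_term (1/2) n) = 32" .

  have s: "sin (of_real pi / 6 :: complex) = 1/2" "sin (of_real pi / 3 :: complex) = of_real (sqrt 3) / 2"
    using arg_cong[OF sin_30, of complex_of_real] arg_cong[OF sin_60, of complex_of_real]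
    by (simp_all flip: sin_of_real)
  have G6: "Gamma (1/6) * Gamma (5/6 :: complex) = 2 * of_real pi"
    using Gamma_reflection_complex[of "1/6"] s by simp
  have G3: "Gamma (1/3) * Gamma (2/3 :: complex) = 2 * of_real pi / of_real (sqrt 3)"
    using Gamma_reflection_complex[of "1/3"] s by simp
  have G43: "Gamma (4/3 :: complex) = 1/3 * Gamma (1/3)"
  proof -
    have "1/3 \<notin> (\<int>\<^sub>\<le>\<^sub>0 :: complex set)"
      by (rule Re_pos_notin_nonpos_Ints, simp)+
    from Gamma_plus1[OF this] show ?thesis by simp
  qed
  have G32: "Gamma (3/2 :: complex) = of_real (sqrt pi) / 2"
  proof -
    have "1/2 \<notin> (\<int>\<^sub>\<le>\<^sub>0 :: complex set)"
      by (rule Re_pos_notin_nonpos_Ints, simp)+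
    from Gamma_plus1[OF this] show ?thesis by (simp add: Gamma_one_half_complex)
  qed
  have r: "rising (1/2) (1/2) = 1 / of_real (sqrt pi)"
     "rising 1 (1/2) = of_real (sqrt pi) / 2"
     "rising (1/6) (1/2) = Gamma (2/3) / Gamma (1/6)"
     "rising (5/6) (1/2) = Gamma (4/3) / Gamma (5/6)"
    by (simp_all add: rising_def Gamma_one_half_complex G32)
  have "rising (1/6) (1/2) * rising (5/6) (1/2) = (Gamma (1/3) * Gamma (2/3)) / 3 / (Gamma (1/6) * Gamma (5/6))"
    by (simp add: r G43 mult_ac)
  also have "\<dots> = 1 / (3 * of_real (sqrt 3))" by (simp add: G6 G3)
  finally have "(rising (1/6) (1/2) * rising (5/6) (1/2))^2 = (1 / (3 * of_real (sqrt 3)))^2"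
    by simp
  also have "\<dots> = 1 / (9 * of_real ((sqrt 3)^2))"
    by (simp only: power_divide power_mult_distrib of_real_power) simp
  also have "\<dots> = 1/27" by simp
  finally have r2: "rising (1/6) (1/2) ^ 2 * rising (5/6) (1/2) ^ 2 = 1/27"
    by (simp add: power_mult_distrib)
  have "complex_of_real (729/1024) powr (1/2) = of_real ((729/1024) powr (1/2))"
    by (subst powr_of_real[symmetric]) auto
  also have "(729/1024) powr (1/2) = sqrt ((27/32)^2)"
    by (subst powr_half_sqrt) (auto simp: power2_eq_square)
  finally have pw: "complex_of_real (729/1024) powr (1/2) = 27/32" by simp
  have sp: "complex_of_real (sqrt pi) ^ 6 = of_real pi ^ 3"
  proof -
    have "sqrt pi ^ (2 * 3) = ((sqrt pi)^2)^3" by (rule power_mult)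
    also have "\<dots> = pi ^ 3" by (subst real_sqrt_pow2) simp_all
    finally have "sqrt pi ^ 6 = pi ^ 3" by simp
    thus ?thesis by (metis of_real_power)
  qed
  have "series_value (1/2) = rising (1/2) (1/2) * (rising (1/6) (1/2) ^ 2 * rising (5/6) (1/2) ^ 2)
      / rising 1 (1/2) ^ 5 * complex_of_real (729/1024) powr (1/2) * 32"
    unfolding series_value_def sum term_prefactor_def by (simp only: mult_ac)
  also have "\<dots> = 1 / of_real (sqrt pi) * (1/27) / (of_real (sqrt pi) / 2)^5 * (27/32) * 32"
    unfolding r2 pw r(1,2) ..
  also have "\<dots> = 32 / complex_of_real (sqrt pi) ^ 6"
    by (simp add: power_divide eval_nat_numeral)
  finally show ?thesis unfolding sp .
qed

lemma series_term_sums: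
  assumes "admissible k"
  shows "series_term k sums (32 / of_real pi ^ 3)"
proof -
  have val: "series_value w = 32 / of_real pi ^ 3" if "Re w > 0" for w
  proof -
    have "series_value w = periodic_value w" using periodic_value_eq[of w 0] that by simp
    also have "\<dots> = periodic_value (1/2)"
      by (rule periodic_entire_constant[OF holomorphic_periodic_value periodic_value_plus_1
            norm_periodic_value_le])
    also have "\<dots> = series_value (1/2)" using periodic_value_eq[of "1/2" 0] by simp
    finally show ?thesis by (simp add: series_value_half)
  qed
  obtain m :: nat where "real m > - Re k" using reals_Archimedean2 by blast
  hence m: "Re (k + of_nat m) > 0" by simp
  have "series_term (k + of_nat m) sums (32 / of_real pi ^ 3)"
    using series_term_sums_series_value[OF m] val[OF m] by simp
  with assms show ?thesis by (rule series_term_sums_shift_nat)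
qed

section \<open>Exceptional parameters and the case \<open>k = 0\<close>\<close>

lemma six_times_not_admissible:
  assumes "\<not> admissible k" shows "6 * k \<in> \<int>"
proof -
  have *: "c * z \<in> \<int>" if "z \<in> \<int>\<^sub>\<le>\<^sub>0" "c \<in> \<int>" for z c :: complex
    using that nonpos_Ints_subset_Ints by (auto intro: Ints_mult)
  from assms consider "2 * k \<in> \<int>\<^sub>\<le>\<^sub>0" | "k + 1/6 \<in> \<int>\<^sub>\<le>\<^sub>0" | "k + 5/6 \<in> \<int>\<^sub>\<le>\<^sub>0"
    by (auto simp: admissible_def)
  thus ?thesis
  proof cases
    case 1
    from *[OF this, of 3] show ?thesis by simp
  next
    case 2
    from Ints_diff[OF *[OF this, of 6], of 1] show ?thesis by (simp add: algebra_simps)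
  next
    case 3
    from Ints_diff[OF *[OF this, of 6], of 5] show ?thesis by (simp add: algebra_simps)
  qed
qed

lemma not_admissible_isolated:
  assumes k: "\<not> admissible k" and w: "w \<in> ball k (1/6)" "w \<noteq> k"
  shows "admissible w"
proof (rule ccontr)
  assume "\<not> admissible w"
  with k have "6 * w - 6 * k \<in> \<int>" by (intro Ints_diff six_times_not_admissible)
  moreover have "norm (6 * w - 6 * k) < 1"
  proof -
    have "norm (6 * w - 6 * k) = 6 * dist k w"
      by (simp add: dist_norm norm_mult norm_minus_commute[of k w]
            right_diff_distrib[of "6 :: complex", symmetric] del: right_diff_distrib_numeral)
    thus ?thesis using w by simp
  qed
  moreover obtain i where i: "6 * w - 6 * k = of_int i"
    using \<open>6 * w - 6 * k \<in> \<int>\<close> by (rule Ints_cases)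
  ultimately have "i = 0" by simp
  with i w show False by simp
qed

lemma removable_singularity_series:
  assumes "\<not> admissible k"
  shows "removable_singularity_at (\<lambda>w. \<Sum>n. series_term w n) k"
proof -
  let ?c = "32 / complex_of_real pi ^ 3"
  have eq: "(\<Sum>n. series_term w n) = ?c" if "w \<in> ball k (1/6) - {k}" for w
    using series_term_sums[OF not_admissible_isolated[OF assms, of w]] that
    by (auto simp: sums_iff)
  have "(\<lambda>w. \<Sum>n. series_term w n) analytic_on ball k (1/6) - {k}"
  proof -
    have "(\<lambda>_. ?c) holomorphic_on ball k (1/6) - {k}" by (rule holomorphic_on_const)
    hence "(\<lambda>w. \<Sum>n. series_term w n) holomorphic_on ball k (1/6) - {k}"
      by (rule holomorphic_transform) (use eq in simp)
    thus ?thesis by (simp add: analytic_on_open open_delete)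
  qed
  hence "isolated_singularity_at (\<lambda>w. \<Sum>n. series_term w n) k"
    unfolding isolated_singularity_at_def by (intro exI[of _ "1/6"]) simp
  moreover have "(\<lambda>w. \<Sum>n. series_term w n) \<midarrow>k\<rightarrow> ?c"
  proof (rule Lim_transform_within_open[OF tendsto_const])
    show "open (ball k (1/6))" "k \<in> ball k (1/6)" by auto
    show "?c = (\<Sum>n. series_term w n)" if "w \<in> ball k (1/6)" "w \<noteq> k" for w
      using eq[of w] that by simp
  qed
  ultimately show ?thesis unfolding removable_singularity_at_def by blast
qed

lemma gourevitch_series:
  "(\<lambda>n :: nat. pochhammer (1/2 :: real) n ^ 7 / pochhammer 1 n ^ 7 * (1/64) ^ n
     * (6 * real n + 1) * (28 * real n ^ 2 + 8 * real n + 1)) sums (32 / pi ^ 3)"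
  (is "?t sums _")
proof -
  have "1/6 \<notin> (\<int>\<^sub>\<le>\<^sub>0 :: complex set)" "5/6 \<notin> (\<int>\<^sub>\<le>\<^sub>0 :: complex set)"
    by (rule Re_pos_notin_nonpos_Ints, simp)+
  hence "admissible 0" by (simp add: admissible_def)
  hence "series_term 0 sums of_real (32 / pi ^ 3)"
    using series_term_sums[of 0] by simp
  also have "series_term 0 = (\<lambda>n. complex_of_real (?t n))"
  proof
    fix n
    have p: "pochhammer (1/2 :: complex) n = of_real (pochhammer (1/2) n)"
      "pochhammer (1 :: complex) n = of_real (pochhammer 1 n)"
      using pochhammer_of_real[of "1/2 :: real" n, where 'a = complex]
        pochhammer_of_real[of "1 :: real" n, where 'a = complex] by simp_all
    have c: "x ^ 2 * x ^ 2 * x ^ 3 = x ^ 7" for x :: complex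
      by (simp flip: power_add)
    have r: "rising a 0 = 1" if "Re a > 0" for a
      using that by (simp add: rising_def Gamma_eq_zero_iff Re_pos_notin_nonpos_Ints)
    show "series_term 0 n = complex_of_real (?t n)"
      by (simp add: series_term_def r p c)
  qed
  finally show ?thesis by (simp only: sums_of_real_iff)
qed

theorem mainTheorem5:
  shows "(\<forall>k :: complex. admissible k \<longrightarrow>
            series_term k sums (32 / complex_of_real pi ^ 3)) \<and>
         (\<forall>k :: complex. \<not> admissible k \<longrightarrow>
            removable_singularity_at (\<lambda>w. \<Sum>n. series_term w n) k) \<and>
         (\<lambda>n :: nat. pochhammer (1/2 :: real) n ^ 7 / pochhammer 1 n ^ 7 * (1/64) ^ n
            * (6 * real n + 1) * (28 * real n ^ 2 + 8 * real n + 1)) sums (32 / pi ^ 3)"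
  using series_term_sums removable_singularity_series gourevitch_series by blast

end
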